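(* Let $G$ be a finite connected simple graph with vertices $u_1,\dots,u_n$ ($n\ge 2$), equipped with an edge-length function $l$. Let $\widetilde G$ be the graph obtained by adding a new vertex $u_{n+1}$ and a single new edge $u_nu_{n+1}$, and for $t>0$ let $l_t$ be the edge-length function on $\widetilde G$ extending $l$ with $l_t(u_nu_{n+1})=t$. Then, as $t\to 0^+$: (i) the largest eigenvalue of the Fujiwara Laplacian $\Delta_{l_t}$ of $(\widetilde G,l_t)$ diverges to $+\infty$; (ii) the remaining $n$ eigenvalues of $\Delta_{l_t}$ (in increasing order, with multiplicity) converge to the $n$ eigenvalues of the Fujiwara Laplacian $\Delta_l$ of $(G,l)$ (in increasing order, with multiplicity). In particular $\lim_{t\to0}\lambda_1(\widetilde G,l_t)=\lambda_1(G,l)$, and consequently $\Lambda_1(\widetilde G)\ge\Lambda_1(G)$.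
   Context: For a finite connected simple graph $G=(V,E)$ and an edge-length function $l\colon E\to\mathbb{R}_{>0}$, define $m_0(u)=\sum_{v\sim u} l(uv)$ and $m_1(uv)=1/l(uv)$. The Fujiwara Laplacian is $(\Delta_l\varphi)(u)=\sum_{v\sim u}\frac{m_1(uv)}{m_0(u)}(\varphi(u)-\varphi(v))$ for $\varphi\colon V\to\mathbb{R}$; it is self-adjoint and nonnegative for the inner product $\langle\varphi_1,\varphi_2\rangle=\sum_u m_0(u)\varphi_1(u)\varphi_2(u)$, with kernel the constants; $\lambda_1(G,l)$ is its smallest positive eigenvalue. $\Lambda_1(G)=\sup_l\lambda_1(G,l)$ over all $l$ with $\sum_u m_0(u)=2\sum_{uv\in E}l(uv)=1$; equivalently $\Lambda_1(G)=\sup_l \lambda_1(G,l)\bigl(\sum_u m_0(u)\bigr)^2$ over all unnormalized $l$. *)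

theory Defs
  imports "HOL-Analysis.Analysis"
begin

text \<open>
  A finite simple graph has the whole finite type \<open>'v\<close> as its vertex set and
  two-element subsets of \<open>'v\<close> as its edges. An edge-length function
  is a total function of which only the values on the edges matter.
\<close>

definition simple_graph :: "'v set set \<Rightarrow> bool" where
  "simple_graph E \<longleftrightarrow> (\<forall>e\<in>E. card e = 2)"

definition connected_graph :: "'v set set \<Rightarrow> bool" where
  "connected_graph E \<longleftrightarrow> (\<forall>u v. (u, v) \<in> {(x, y). {x, y} \<in> E}\<^sup>*)"

definition edge_length :: "'v set set \<Rightarrow> ('v set \<Rightarrow> real) \<Rightarrow> bool" where
  "edge_length E l \<longleftrightarrow> (\<forall>e\<in>E. 0 < l e)"

definition m0 :: "'v::finite set set \<Rightarrow> ('v set \<Rightarrow> real) \<Rightarrow> 'v \<Rightarrow> real" where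
  "m0 E l u = (\<Sum>v | {u, v} \<in> E. l {u, v})"

definition m1 :: "('v set \<Rightarrow> real) \<Rightarrow> 'v set \<Rightarrow> real" where
  "m1 l e = 1 / l e"

definition fujiwara_laplacian ::
  "'v::finite set set \<Rightarrow> ('v set \<Rightarrow> real) \<Rightarrow> real ^ 'v \<Rightarrow> real ^ 'v" where
  "fujiwara_laplacian E l \<phi> =
     (\<chi> u. \<Sum>v | {u, v} \<in> E. m1 l {u, v} / m0 E l u * (\<phi> $ u - \<phi> $ v))"

definition eigenspace :: "('a::real_vector \<Rightarrow> 'a) \<Rightarrow> real \<Rightarrow> 'a set" where
  "eigenspace T c = {x. T x = c *\<^sub>R x}"

definition is_eigenvalue :: "('a::real_vector \<Rightarrow> 'a) \<Rightarrow> real \<Rightarrow> bool" where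
  "is_eigenvalue T c \<longleftrightarrow> (\<exists>x. x \<noteq> 0 \<and> x \<in> eigenspace T c)"

text \<open>
  The eigenvalues in increasing order, each repeated according to its multiplicity.
  For a self-adjoint operator, the dimension of the eigenspace is the
  multiplicity, and the list has the dimension of the whole space as its length.
\<close>

definition eigenvalue_list :: "('a::euclidean_space \<Rightarrow> 'a) \<Rightarrow> real list" where
  "eigenvalue_list T =
     concat (map (\<lambda>c. replicate (dim (eigenspace T c)) c)
       (sorted_list_of_set {c. is_eigenvalue T c}))"

definition lambda1 :: "'v::finite set set \<Rightarrow> ('v set \<Rightarrow> real) \<Rightarrow> real" where
  "lambda1 E l = (LEAST c. 0 < c \<and> is_eigenvalue (fujiwara_laplacian E l) c)"

text \<open>
  The supremum is taken in the extended reals, because it can be infinite: on a triangle with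
  edge lengths \<open>1/2 - 2 * \<epsilon>\<close>, \<open>\<epsilon>\<close>, \<open>\<epsilon>\<close> the
  smallest positive eigenvalue tends to infinity as \<open>\<epsilon>\<close> tends to \<open>0\<close>.
\<close>

definition Lambda1 :: "'v::finite set set \<Rightarrow> ereal" where
  "Lambda1 E =
     (SUP l \<in> {l. edge_length E l \<and> (\<Sum>u\<in>UNIV. m0 E l u) = 1}. ereal (lambda1 E l))"

text \<open>
  Attaching a pendant edge at \<open>u\<close>: the new vertex is \<^term>\<open>None\<close>, and an old
  vertex \<open>v\<close> becomes \<^term>\<open>Some v\<close>.
\<close>

definition pendant_graph :: "'v set set \<Rightarrow> 'v \<Rightarrow> 'v option set set" where
  "pendant_graph E u = insert {Some u, None} ((\<lambda>e. Some ` e) ` E)"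

definition pendant_length :: "('v set \<Rightarrow> real) \<Rightarrow> 'v \<Rightarrow> real \<Rightarrow> 'v option set \<Rightarrow> real" where
  "pendant_length l u t e = (if e = {Some u, None} then t else l (Some -` e))"

end

theory Submission
  imports Defs
begin

text \<open>
  Conjugating by the square root of \<open>m0\<close> makes the Fujiwara Laplacian self-adjoint for the standard
  inner product, so by Courant and Fischer its \<open>k\<close>-th eigenvalue (counted from \<open>0\<close>) is at most \<open>c\<close>
  iff some subspace of dimension \<open>k + 1\<close> satisfies \<open>dirichlet \<le> c * mass\<close>. Extending
  functions to the pendant vertex by their value at \<open>u\<close> preserves the Dirichlet energy and does not
  decrease the mass, which gives \<open>\<lambda>\<^sub>k(t) \<le> \<lambda>\<^sub>k\<close>. Conversely the pendant edge contributes
  \<open>(\<phi>(u) - \<phi>(None))\<^sup>2 / t\<close> to the energy, so on functions of bounded Rayleigh quotient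
  the restriction to the old graph is injective and keeps the mass up to a factor tending to \<open>1\<close>; this
  gives the reverse inequality up to that factor. The indicator of the
  pendant vertex has Rayleigh quotient \<open>1 / t\<^sup>2\<close>, whence the largest eigenvalue diverges.
\<close>

section \<open>Self-adjoint operators\<close>

text \<open>Sortedness makes the entries up to \<open>c\<close> an initial segment, so a bound on
  the \<open>k\<close>-th eigenvalue becomes a count of eigenvalues, that is, a dimension.\<close>

lemma sorted_nth_le_iff:
  fixes c :: "'a::linorder"
  assumes "sorted xs" "k < length xs"
  shows "xs ! k \<le> c \<longleftrightarrow> k < length (filter (\<lambda>x. x \<le> c) xs)"
  using assms
proof (induction xs arbitrary: k)
  case (Cons x xs)
  show ?case
  proof (cases "x \<le> c")
    case True
    then show ?thesis using Cons by (cases k) auto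
  next
    case False
    then have "filter (\<lambda>x. x \<le> c) (x # xs) = []" using Cons.prems by (auto simp: filter_empty_conv)
    moreover have "x \<le> (x # xs) ! k" using Cons.prems by (cases k) auto
    ultimately show ?thesis using False by simp
  qed
qed simp

locale self_adjoint =
  fixes T :: "'a::euclidean_space \<Rightarrow> 'a"
  assumes linear: "linear T" and adjoint: "T x \<bullet> y = x \<bullet> T y"
begin

lemma subspace_eigenspace: "subspace (eigenspace T c)"
  unfolding eigenspace_def subspace_def
  by (auto simp: linear_0[OF linear] linear_add[OF linear] linear_scale[OF linear] algebra_simps)

text \<open>Variational argument: a maximizer of \<open>T x \<bullet> x\<close> on the compact unit
  sphere of \<open>V\<close> is an eigenvector, because the first variation in every direction of
  \<open>V\<close> vanishes there.\<close>

lemma eigenvector_in_invariant_subspace: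
  assumes V: "subspace V" "T ` V \<subseteq> V" "V \<noteq> {0}"
  obtains x c where "x \<in> V" "x \<noteq> 0" "x \<in> eigenspace T c"
proof -
  define K where "K = V \<inter> sphere 0 1"
  have "compact K" unfolding K_def
    by (intro closed_Int_compact closed_subspace V compact_sphere)
  moreover have "K \<noteq> {}"
  proof -
    obtain x where x: "x \<in> V" "x \<noteq> 0" using V subspace_0 by blast
    then have "x /\<^sub>R norm x \<in> K" using V(1) by (auto simp: K_def subspace_scale)
    then show ?thesis by blast
  qed
  moreover have "continuous_on K (\<lambda>x. T x \<bullet> x)"
    by (intro continuous_intros linear_continuous_on linear_linear[THEN iffD1] linear)
       (simp add: linear linear_conv_bounded_linear[symmetric])
  ultimately obtain x where x: "x \<in> K" and mx: "\<And>y. y \<in> K \<Longrightarrow> T y \<bullet> y \<le> T x \<bullet> x"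
    using continuous_attains_sup[of K "\<lambda>x. T x \<bullet> x"] by blast
  define c where "c = T x \<bullet> x"
  have xV: "x \<in> V" and nx: "x \<bullet> x = 1"
    using x by (auto simp: K_def norm_eq_1)
  have bound: "T y \<bullet> y \<le> c * (y \<bullet> y)" if "y \<in> V" for y
  proof (cases "y = 0")
    case False
    then have "y /\<^sub>R norm y \<in> K" using V(1) that by (auto simp: K_def subspace_scale)
    from mx[OF this] False show ?thesis
      by (simp add: c_def linear_scale[OF linear] divide_simps power2_norm_eq_inner flip: power2_eq_square)
  qed simp
  have orth: "(T x - c *\<^sub>R x) \<bullet> y = 0" if y: "y \<in> V" for y
  proof -
    define b where "b = (T x - c *\<^sub>R x) \<bullet> y"
    define a where "a = c * (y \<bullet> y) - T y \<bullet> y"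
    \<comment> \<open>Applying \<open>bound\<close> to \<open>x + r *\<^sub>R y\<close> cancels the
      terms of order zero in \<open>r\<close>.\<close>
    have quad: "2 * r * b \<le> r\<^sup>2 * a" for r
    proof -
      have "x + r *\<^sub>R y \<in> V" using V(1) xV y by (simp add: subspace_add subspace_scale)
      from bound[OF this] have "(T x + r *\<^sub>R T y) \<bullet> (x + r *\<^sub>R y) \<le> c * ((x + r *\<^sub>R y) \<bullet> (x + r *\<^sub>R y))"
        by (simp add: linear_add[OF linear] linear_scale[OF linear])
      moreover have "T y \<bullet> x = T x \<bullet> y" using adjoint[of y x] by (simp add: inner_commute)
      ultimately show ?thesis
        using nx by (simp add: a_def b_def c_def[symmetric] inner_add inner_diff inner_commute[of y x]
            algebra_simps power2_eq_square)
    qed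
    have a0: "a \<ge> 0" using bound[OF y] by (simp add: a_def)
    \<comment> \<open>A sufficiently small positive multiple of \<open>b\<close> as \<open>r\<close>
      forces \<open>b = 0\<close>; dividing by \<open>a + 1\<close> rather than \<open>a\<close>
      stays valid when \<open>a = 0\<close>.\<close>
    have "2 * (b / (a + 1)) * b \<le> (b / (a + 1))\<^sup>2 * a" by (rule quad)
    then have "2 * b\<^sup>2 * (a + 1) \<le> b\<^sup>2 * a"
      using a0 by (simp add: divide_simps power2_eq_square split: if_splits)
    then have "b\<^sup>2 * (a + 2) \<le> 0" by (simp add: algebra_simps)
    then have "b = 0" using a0 by (simp add: mult_le_0_iff)
    then show ?thesis by (simp add: b_def)
  qed
  \<comment> \<open>Invariance puts the residual into \<open>V\<close>, so \<open>orth\<close> makes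
    it orthogonal to itself.\<close>
  have "T x - c *\<^sub>R x \<in> V" using V xV by (auto intro: subspace_diff subspace_scale)
  from orth[OF this] have "T x = c *\<^sub>R x" by simp
  moreover have "x \<noteq> 0" using nx by auto
  ultimately show ?thesis using that xV by (auto simp: eigenspace_def)
qed

lemma eigenspaces_orthogonal:
  assumes "x \<in> eigenspace T c" "y \<in> eigenspace T d" "c \<noteq> d"
  shows "x \<bullet> y = 0"
proof -
  have "c * (x \<bullet> y) = d * (x \<bullet> y)"
    using assms(1,2) adjoint[of x y] by (simp add: eigenspace_def)
  with assms(3) show ?thesis by simp
qed

text \<open>Eigenvectors for distinct eigenvalues are orthogonal, so choosing one for each gives an
  independent set. Finiteness matters because \<open>sorted_list_of_set\<close> returns the empty
  list on an infinite set.\<close>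

lemma finite_eigenvalues: "finite {c. is_eigenvalue T c}"
proof -
  define f where "f c = (SOME x. x \<noteq> 0 \<and> x \<in> eigenspace T c)" for c
  have f: "f c \<noteq> 0 \<and> f c \<in> eigenspace T c" if "is_eigenvalue T c" for c
    using that unfolding f_def is_eigenvalue_def by (rule someI_ex)
  have orth: "f c \<bullet> f d = 0" if "is_eigenvalue T c" "is_eigenvalue T d" "c \<noteq> d" for c d
    using eigenspaces_orthogonal f that by blast
  have "pairwise orthogonal (f ` {c. is_eigenvalue T c})"
    using orth by (auto simp: pairwise_def orthogonal_def)
  then have "finite (f ` {c. is_eigenvalue T c})"
    using f by (intro independent_imp_finite pairwise_orthogonal_independent) force+
  moreover have "inj_on f {c. is_eigenvalue T c}"
    using orth f by (intro inj_onI) (metis inner_eq_zero_iff mem_Collect_eq)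
  ultimately show ?thesis using finite_imageD by blast
qed

section \<open>Spectral subspaces and the spectral theorem\<close>

definition spectral_subspace :: "real set \<Rightarrow> 'a set" where
  "spectral_subspace C = span (\<Union>c\<in>C. eigenspace T c)"

lemma subspace_spectral_subspace [simp]: "subspace (spectral_subspace C)"
  by (simp add: spectral_subspace_def)

lemma spectral_subspace_Un:
  "spectral_subspace (C \<union> D) = {x + y |x y. x \<in> spectral_subspace C \<and> y \<in> spectral_subspace D}"
  by (simp add: spectral_subspace_def span_Un UN_Un)

lemma spectral_subspace_singleton: "spectral_subspace {c} = eigenspace T c"
  by (simp add: spectral_subspace_def span_eq_iff subspace_eigenspace)

lemma spectral_subspace_invariant: "x \<in> spectral_subspace C \<Longrightarrow> T x \<in> spectral_subspace C"
  unfolding spectral_subspace_def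
proof (induction rule: span_induct)
  case base
  show ?case
    using linear_subspace_vimage[OF linear subspace_span] by (simp add: vimage_def)
next
  case (step x)
  then obtain c where "c \<in> C" "x \<in> eigenspace T c" by blast
  moreover from this have "T x = c *\<^sub>R x" by (simp add: eigenspace_def)
  ultimately show ?case by (auto intro: span_scale[OF span_base])
qed

lemma spectral_subspace_orthogonal:
  assumes "C \<inter> D = {}" "x \<in> spectral_subspace C" "y \<in> spectral_subspace D"
  shows "x \<bullet> y = 0"
proof -
  have "orthogonal y x" if "y \<in> (\<Union>c\<in>D. eigenspace T c)" for y
    using assms(1,2) that eigenspaces_orthogonal unfolding spectral_subspace_def
    by (intro orthogonal_to_span[of x]) (auto simp: orthogonal_def, blast)
  then show ?thesis using orthogonal_to_span[of y "\<Union>c\<in>D. eigenspace T c" x] assms(3)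
    by (auto simp: spectral_subspace_def orthogonal_def inner_commute)
qed

text \<open>The two summands are orthogonal and meet only in \<open>0\<close>, so the dimension
  formula for sums has no correction term.\<close>

lemma dim_spectral_subspace_Un:
  assumes "C \<inter> D = {}"
  shows "dim (spectral_subspace (C \<union> D)) = dim (spectral_subspace C) + dim (spectral_subspace D)"
proof -
  have "spectral_subspace C \<inter> spectral_subspace D \<subseteq> {0}"
    using spectral_subspace_orthogonal[OF assms] by (metis Int_iff inner_eq_zero_iff singletonI subsetI)
  then have "dim (spectral_subspace C \<inter> spectral_subspace D) = 0" by simp
  then show ?thesis
    using dim_sums_Int[of "spectral_subspace C" "spectral_subspace D"]
    by (simp add: spectral_subspace_Un del: dim_eq_0)
qed

lemma dim_spectral_subspace:
  "finite C \<Longrightarrow> dim (spectral_subspace C) = (\<Sum>c\<in>C. dim (eigenspace T c))"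
proof (induction rule: finite_induct)
  case empty
  then show ?case by (simp add: spectral_subspace_def)
next
  case (insert c C)
  then show ?case
    using dim_spectral_subspace_Un[of "{c}" C] by (simp add: spectral_subspace_singleton)
qed

text \<open>The orthogonal complement of the sum of all eigenspaces is invariant by
  self-adjointness. Were it nonzero, it would contain an eigenvector, which also lies in that sum
  and would be orthogonal to itself.\<close>

lemma spectral_subspace_eigenvalues: "spectral_subspace {c. is_eigenvalue T c} = UNIV"
proof (rule ccontr)
  let ?W = "spectral_subspace {c. is_eigenvalue T c}"
  let ?V = "{y. \<forall>x\<in>?W. orthogonal x y}"
  assume "?W \<noteq> UNIV"
  then have "dim ?W \<noteq> DIM('a)"
    by (metis dim_eq_full span_eq_iff subspace_spectral_subspace)
  moreover have "dim ?V + dim ?W = DIM('a)"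
    using dim_subspace_orthogonal_to_vectors[of ?W UNIV] by simp
  ultimately have "?V \<noteq> {0}" by auto
  moreover have "subspace ?V" by (rule subspace_orthogonal_to_vectors)
  moreover have "T ` ?V \<subseteq> ?V"
  proof safe
    fix y x assume "\<forall>x\<in>?W. orthogonal x y" "x \<in> ?W"
    then show "orthogonal x (T y)"
      using spectral_subspace_invariant[of x] adjoint[of x y] by (simp add: orthogonal_def)
  qed
  ultimately obtain x c where x: "x \<in> ?V" "x \<noteq> 0" "x \<in> eigenspace T c"
    using eigenvector_in_invariant_subspace by blast
  then have "x \<in> ?W" unfolding spectral_subspace_def
    by (intro span_base) (auto simp: is_eigenvalue_def)
  with x show False by (auto simp: orthogonal_def)
qed

text \<open>Parseval: the witness \<open>w c\<close> is the squared norm of the component of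
  \<open>x\<close> in the eigenspace of \<open>c\<close>. Both forms become weighted sums that can
  be compared term by term.\<close>

lemma spectral_decomposition:
  assumes "finite C" "x \<in> spectral_subspace C"
  obtains w where "\<And>c. w c \<ge> 0" "x \<bullet> x = (\<Sum>c\<in>C. w c)" "T x \<bullet> x = (\<Sum>c\<in>C. c * w c)"
proof -
  have "\<exists>w. (\<forall>c. w c \<ge> 0) \<and> x \<bullet> x = (\<Sum>c\<in>C. w c) \<and> T x \<bullet> x = (\<Sum>c\<in>C. c * w c)"
    using assms
  proof (induction arbitrary: x rule: finite_induct)
    case empty
    then show ?case by (auto simp: spectral_subspace_def)
  next
    case (insert c C)
    then obtain a y where x: "x = a + y" and a: "a \<in> eigenspace T c" and y: "y \<in> spectral_subspace C"
      using spectral_subspace_Un[of "{c}" C] by (auto simp: spectral_subspace_singleton)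
    obtain w where w: "\<forall>c. w c \<ge> 0" "y \<bullet> y = (\<Sum>c\<in>C. w c)" "T y \<bullet> y = (\<Sum>c\<in>C. c * w c)"
      using insert.IH[OF y] by auto
    have ay: "a \<bullet> z = 0" if "z \<in> spectral_subspace C" for z
      using spectral_subspace_orthogonal[of "{c}" C a z] a that insert.hyps
      by (auto simp: spectral_subspace_singleton)
    have 1: "a \<bullet> y = 0" "a \<bullet> T y = 0" using ay y spectral_subspace_invariant by auto
    have 2: "T a = c *\<^sub>R a" using a by (simp add: eigenspace_def)
    let ?w = "w(c := a \<bullet> a)"
    have 3: "(\<Sum>d\<in>C. ?w d) = (\<Sum>d\<in>C. w d)" "(\<Sum>d\<in>C. d * ?w d) = (\<Sum>d\<in>C. d * w d)"
      using insert.hyps by (auto intro!: sum.cong)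
    have "(\<forall>c. ?w c \<ge> 0) \<and> x \<bullet> x = (\<Sum>c\<in>insert c C. ?w c) \<and>
      T x \<bullet> x = (\<Sum>c\<in>insert c C. c * ?w c)"
      unfolding sum.insert[OF insert.hyps] 3 using w 1 2
      by (simp add: x inner_add inner_commute[of y a] inner_commute[of "T y" a] linear_add[OF linear])
    then show ?case by blast
  qed
  then show ?thesis using that by blast
qed

section \<open>The eigenvalue list and the min-max principle\<close>

text \<open>Each eigenvalue is listed as often as its eigenspace has dimensions, and these
  dimensions add up over distinct eigenvalues.\<close>

lemma length_filter_eigenvalue_list:
  "length (filter P (eigenvalue_list T)) = dim (spectral_subspace {c. is_eigenvalue T c \<and> P c})"
proof -
  have "length (filter P (concat (map (\<lambda>c. replicate (d c) c) xs))) = (\<Sum>c\<leftarrow>filter P xs. d c)"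
    for d :: "real \<Rightarrow> nat" and xs
    by (induction xs) auto
  then have "length (filter P (eigenvalue_list T)) =
      (\<Sum>c\<leftarrow>filter P (sorted_list_of_set {c. is_eigenvalue T c}). dim (eigenspace T c))"
    by (simp add: eigenvalue_list_def)
  also have "\<dots> = (\<Sum>c\<in>{c. is_eigenvalue T c \<and> P c}. dim (eigenspace T c))"
    by (subst sum_list_distinct_conv_sum_set) (auto simp: finite_eigenvalues intro!: sum.cong)
  finally show ?thesis
    using finite_eigenvalues by (simp add: dim_spectral_subspace)
qed

lemma length_eigenvalue_list: "length (eigenvalue_list T) = DIM('a)"
  using length_filter_eigenvalue_list[of "\<lambda>_. True"] by (simp add: spectral_subspace_eigenvalues)

lemma sorted_eigenvalue_list: "sorted (eigenvalue_list T)"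
proof -
  have "sorted (concat (map (\<lambda>c. replicate (d c) c) xs))" if "sorted xs"
    for d :: "real \<Rightarrow> nat" and xs
    using that by (induction xs) (auto simp: sorted_append sorted_replicate)
  then show ?thesis by (simp add: eigenvalue_list_def)
qed

lemma set_eigenvalue_list: "set (eigenvalue_list T) = {c. is_eigenvalue T c}"
proof -
  have "\<not> eigenspace T c \<subseteq> {0}" if "is_eigenvalue T c" for c
    using that by (auto simp: is_eigenvalue_def)
  then show ?thesis
    by (auto simp: eigenvalue_list_def set_sorted_list_of_set[OF finite_eigenvalues])
qed

text \<open>The threshold \<open>c\<close> in place of a minimum over subspaces lets two spectra be
  compared by carrying a single subspace from one space to the other.\<close>

theorem courant_fischer:
  assumes k: "k < DIM('a)"
  shows "eigenvalue_list T ! k \<le> c \<longleftrightarrow>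
    (\<exists>V. subspace V \<and> dim V = Suc k \<and> (\<forall>x\<in>V. T x \<bullet> x \<le> c * (x \<bullet> x)))"
proof -
  \<comment> \<open>\<open>A\<close> and \<open>B\<close> split the spectrum at \<open>c\<close>:
    the Rayleigh quotient is at most \<open>c\<close> on nonzero vectors of the spectral subspace of
    \<open>A\<close> and above \<open>c\<close> on those of \<open>B\<close>.\<close>
  define A where "A = {d. is_eigenvalue T d \<and> d \<le> c}"
  define B where "B = {d. is_eigenvalue T d \<and> d > c}"
  have fin: "finite A" "finite B" using finite_eigenvalues by (auto simp: A_def B_def)
  have "A \<inter> B = {}" "A \<union> B = {d. is_eigenvalue T d}" by (auto simp: A_def B_def)
  then have dims: "dim (spectral_subspace A) + dim (spectral_subspace B) = DIM('a)"
    using dim_spectral_subspace_Un[of A B] by (simp add: spectral_subspace_eigenvalues)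
  have "eigenvalue_list T ! k \<le> c \<longleftrightarrow> k < dim (spectral_subspace A)"
    using sorted_nth_le_iff[OF sorted_eigenvalue_list] k
    by (simp add: length_eigenvalue_list length_filter_eigenvalue_list A_def)
  also have "\<dots> \<longleftrightarrow> (\<exists>V. subspace V \<and> dim V = Suc k \<and> (\<forall>x\<in>V. T x \<bullet> x \<le> c * (x \<bullet> x)))"
  proof
    assume "k < dim (spectral_subspace A)"
    then obtain V where V: "subspace V" "V \<subseteq> span (spectral_subspace A)" "dim V = Suc k"
      using choose_subspace_of_subspace[of "Suc k" "spectral_subspace A"] by (auto simp: Suc_le_eq)
    have "T x \<bullet> x \<le> c * (x \<bullet> x)" if "x \<in> V" for x
    proof -
      have "x \<in> spectral_subspace A" using V that by (metis span_eq_iff subsetD subspace_spectral_subspace)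
      from spectral_decomposition[OF fin(1) this] obtain w where
        w: "\<And>c. w c \<ge> 0" "x \<bullet> x = (\<Sum>c\<in>A. w c)" "T x \<bullet> x = (\<Sum>c\<in>A. c * w c)" by blast
      show ?thesis unfolding w(2,3) sum_distrib_left
        by (intro sum_mono mult_right_mono w) (simp add: A_def)
    qed
    with V show "\<exists>V. subspace V \<and> dim V = Suc k \<and> (\<forall>x\<in>V. T x \<bullet> x \<le> c * (x \<bullet> x))" by blast
  next
    assume "\<exists>V. subspace V \<and> dim V = Suc k \<and> (\<forall>x\<in>V. T x \<bullet> x \<le> c * (x \<bullet> x))"
    then obtain V where V: "subspace V" "dim V = Suc k" "\<And>x. x \<in> V \<Longrightarrow> T x \<bullet> x \<le> c * (x \<bullet> x)" by blast
    \<comment> \<open>The weights of a common vector sit on eigenvalues above \<open>c\<close>, so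
      the bound on \<open>V\<close> forces every weight to vanish.\<close>
    have "x = 0" if "x \<in> V" "x \<in> spectral_subspace B" for x
    proof -
      from spectral_decomposition[OF fin(2) that(2)] obtain w where
        w: "\<And>c. w c \<ge> 0" "x \<bullet> x = (\<Sum>c\<in>B. w c)" "T x \<bullet> x = (\<Sum>c\<in>B. c * w c)" by blast
      have "(\<Sum>d\<in>B. (d - c) * w d) \<le> 0"
        using V(3)[OF that(1)] unfolding w(2,3)
        by (simp add: algebra_simps sum_subtractf sum_distrib_left)
      moreover have nn: "(d - c) * w d \<ge> 0" if "d \<in> B" for d using that w(1) by (simp add: B_def)
      ultimately have "(\<Sum>d\<in>B. (d - c) * w d) = 0" by (meson antisym sum_nonneg)
      then have "\<forall>d\<in>B. (d - c) * w d = 0" using nn fin(2) by (simp add: sum_nonneg_eq_0_iff)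
      then have "\<forall>d\<in>B. w d = 0" by (auto simp: B_def)
      then show ?thesis using w(2) by simp
    qed
    then have "V \<inter> spectral_subspace B \<subseteq> {0}" by auto
    then have "dim (V \<inter> spectral_subspace B) = 0" by simp
    then have "dim {x + y |x y. x \<in> V \<and> y \<in> spectral_subspace B} = Suc k + dim (spectral_subspace B)"
      using dim_sums_Int[OF V(1), of "spectral_subspace B"] V(2) by (simp del: dim_eq_0)
    with dim_subset_UNIV[of "{x + y |x y. x \<in> V \<and> y \<in> spectral_subspace B}"]
    have "Suc k + dim (spectral_subspace B) \<le> DIM('a)" by linarith
    with dims show "k < dim (spectral_subspace A)" by simp
  qed
  finally show ?thesis .
qed

end

section \<open>The spectrum of a metric graph\<close>

lemma eigenspace_conjugate:
  assumes "linear D" "\<And>x. P (D x) = x" "\<And>x. D (P x) = x"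
  shows "eigenspace (\<lambda>x. D (T (P x))) c = D ` eigenspace T c"
proof (intro set_eqI iffI)
  fix x assume "x \<in> eigenspace (\<lambda>x. D (T (P x))) c"
  then have "D (T (P x)) = c *\<^sub>R x" by (simp add: eigenspace_def)
  then have "D (T (P x)) = D (c *\<^sub>R P x)" by (simp add: assms linear_scale)
  then have "T (P x) = c *\<^sub>R P x" by (metis assms(2))
  then show "x \<in> D ` eigenspace T c"
    by (intro image_eqI[of _ _ "P x"]) (simp_all add: eigenspace_def assms)
qed (auto simp: eigenspace_def assms linear_scale)

lemma is_eigenvalue_conjugate:
  assumes "linear D" "\<And>x. P (D x) = x" "\<And>x. D (P x) = x"
  shows "is_eigenvalue (\<lambda>x. D (T (P x))) c \<longleftrightarrow> is_eigenvalue T c"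
  unfolding is_eigenvalue_def eigenspace_conjugate[OF assms]
  using assms linear_0[of D] by (metis imageE imageI)

lemma eigenvalue_list_conjugate:
  fixes T :: "'a::euclidean_space \<Rightarrow> 'a"
  assumes "linear D" "\<And>x. P (D x) = x" "\<And>x. D (P x) = x"
  shows "eigenvalue_list (\<lambda>x. D (T (P x))) = eigenvalue_list T"
proof -
  have "inj D" by (metis assms(2) injI)
  then have "dim (D ` V) = dim V" for V
    using assms(1) by (intro dim_image_eq) (auto simp: inj_on_def)
  then show ?thesis
    by (simp add: eigenvalue_list_def eigenspace_conjugate[OF assms] is_eigenvalue_conjugate[OF assms])
qed

section \<open>Dirichlet energy, mass and symmetrization\<close>

text \<open>The sum over ordered pairs meets each edge between distinct vertices twice, hence the
  division by 2.\<close>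

definition dirichlet ::
  "'v::finite set set \<Rightarrow> ('v set \<Rightarrow> real) \<Rightarrow> real ^ 'v \<Rightarrow> real ^ 'v \<Rightarrow> real" where
  "dirichlet E l \<phi> \<psi> =
     (\<Sum>a\<in>UNIV. \<Sum>b | {a, b} \<in> E. (\<phi> $ a - \<phi> $ b) * (\<psi> $ a - \<psi> $ b) / l {a, b}) / 2"

text \<open>Squared norm for the inner product weighted by \<open>m0\<close>;
  \<open>dirichlet\<close> over \<open>mass\<close> is the Rayleigh quotient of the
  Laplacian.\<close>

definition mass :: "'v::finite set set \<Rightarrow> ('v set \<Rightarrow> real) \<Rightarrow> real ^ 'v \<Rightarrow> real" where
  "mass E l \<phi> = (\<Sum>a\<in>UNIV. m0 E l a * (\<phi> $ a)\<^sup>2)"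

lemma sum_adjacent_swap:
  fixes f :: "'v::finite \<Rightarrow> 'v \<Rightarrow> real"
  shows "(\<Sum>a\<in>UNIV. \<Sum>b | {a, b} \<in> E. f a b) = (\<Sum>a\<in>UNIV. \<Sum>b | {a, b} \<in> E. f b a)"
  using sum.swap_restrict[of UNIV UNIV f "\<lambda>a b. {a, b} \<in> E"] by (simp add: insert_commute)

lemma dirichlet_commute: "dirichlet E l \<phi> \<psi> = dirichlet E l \<psi> \<phi>"
  by (simp add: dirichlet_def mult.commute)

lemma linear_fujiwara_laplacian: "linear (fujiwara_laplacian E l)"
proof (intro linearI)
  show "fujiwara_laplacian E l (x + y) = fujiwara_laplacian E l x + fujiwara_laplacian E l y" for x y
    by (simp add: fujiwara_laplacian_def vec_eq_iff flip: sum.distrib)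
       (auto intro!: sum.cong simp: add_diff_add ring_distribs add_divide_distrib)
  show "fujiwara_laplacian E l (r *\<^sub>R x) = r *\<^sub>R fujiwara_laplacian E l x" for r x
    by (simp add: fujiwara_laplacian_def vec_eq_iff sum_distrib_left)
       (auto intro!: sum.cong simp flip: right_diff_distrib)
qed

locale metric_graph =
  fixes E :: "'v::finite set set" and l :: "'v set \<Rightarrow> real"
  assumes edge_length: "edge_length E l" and m0_pos: "0 < m0 E l a"
begin

abbreviation "L \<equiv> fujiwara_laplacian E l"

text \<open>Summation by parts: \<open>m0\<close> cancels the normalization of the Laplacian, and
  averaging with the sum in which the ends of each edge are exchanged produces the differences of
  \<open>\<psi>\<close>.\<close>

lemma green: "(\<Sum>a\<in>UNIV. m0 E l a * (L \<phi> $ a) * \<psi> $ a) = dirichlet E l \<phi> \<psi>"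
proof -
  let ?S = "\<Sum>a\<in>UNIV. \<Sum>b | {a, b} \<in> E. (\<phi> $ a - \<phi> $ b) * \<psi> $ a / l {a, b}"
  let ?S' = "\<Sum>a\<in>UNIV. \<Sum>b | {a, b} \<in> E. (\<phi> $ b - \<phi> $ a) * \<psi> $ b / l {a, b}"
  have "m0 E l a * (m1 l e / m0 E l a * d) * p = d * p / l e" for a e d p
    using m0_pos[of a] by (simp add: m1_def)
  then have "(\<Sum>a\<in>UNIV. m0 E l a * (L \<phi> $ a) * \<psi> $ a) = ?S"
    by (simp add: fujiwara_laplacian_def sum_distrib_left sum_distrib_right)
  moreover have "?S = ?S'"
    by (subst sum_adjacent_swap) (simp add: insert_commute)
  moreover have "?S + ?S' = 2 * dirichlet E l \<phi> \<psi>"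
    by (simp add: dirichlet_def flip: sum.distrib add_divide_distrib)
       (auto intro!: sum.cong simp: algebra_simps)
  ultimately show ?thesis by simp
qed

text \<open>An isometry from the \<open>m0\<close>-weighted inner product to the standard one, which
  makes the general theory of self-adjoint operators applicable.\<close>

definition weigh :: "real ^ 'v \<Rightarrow> real ^ 'v" where "weigh \<phi> = (\<chi> a. sqrt (m0 E l a) * \<phi> $ a)"

definition unweigh :: "real ^ 'v \<Rightarrow> real ^ 'v" where "unweigh \<phi> = (\<chi> a. \<phi> $ a / sqrt (m0 E l a))"

lemma linear_weigh: "linear weigh"
  by (intro linearI) (simp_all add: weigh_def vec_eq_iff algebra_simps)

lemma linear_unweigh: "linear unweigh"
  by (intro linearI) (simp_all add: unweigh_def vec_eq_iff add_divide_distrib)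

lemma sqrt_m0_ne: "sqrt (m0 E l a) \<noteq> 0"
  using m0_pos[of a] by simp

lemma unweigh_weigh: "unweigh (weigh x) = x" and weigh_unweigh: "weigh (unweigh x) = x"
  using sqrt_m0_ne by (simp_all add: weigh_def unweigh_def vec_eq_iff)

lemma inner_weigh: "weigh x \<bullet> weigh y = (\<Sum>a\<in>UNIV. m0 E l a * x $ a * y $ a)"
proof -
  have "sqrt (m0 E l a) * x $ a * (sqrt (m0 E l a) * y $ a) = m0 E l a * x $ a * y $ a" for a
  proof -
    have "sqrt (m0 E l a) * sqrt (m0 E l a) = m0 E l a" using m0_pos[of a] by simp
    moreover have "s * p * (s * q) = s * s * p * q" for s p q :: real by (simp only: mult_ac)
    ultimately show ?thesis by metis
  qed
  then show ?thesis by (simp only: weigh_def inner_vec_def inner_real_def vec_lambda_beta)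
qed

lemma inner_weighted_laplacian: "weigh (L (unweigh x)) \<bullet> y = dirichlet E l (unweigh x) (unweigh y)"
  using inner_weigh[of "L (unweigh x)" "unweigh y"] green[of "unweigh x" "unweigh y"] by (simp add: weigh_unweigh)

sublocale S: self_adjoint "\<lambda>x. weigh (L (unweigh x))"
proof (rule self_adjoint.intro)
  show "linear (\<lambda>x. weigh (L (unweigh x)))"
    using linear_compose[OF linear_compose[OF linear_unweigh linear_fujiwara_laplacian] linear_weigh]
    by (simp add: o_def)
  show "weigh (L (unweigh x)) \<bullet> y = x \<bullet> weigh (L (unweigh y))" for x y
    using inner_weighted_laplacian[of x y] inner_weighted_laplacian[of y x] by (simp add: inner_commute dirichlet_commute)
qed

lemmas conjugate = linear_weigh unweigh_weigh weigh_unweigh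

lemma length_spectrum: "length (eigenvalue_list L) = CARD('v)"
  using S.length_eigenvalue_list by (simp add: eigenvalue_list_conjugate[OF conjugate])

lemma sorted_spectrum: "sorted (eigenvalue_list L)"
  using S.sorted_eigenvalue_list by (simp add: eigenvalue_list_conjugate[OF conjugate])

lemma set_spectrum: "set (eigenvalue_list L) = {c. is_eigenvalue L c}"
  using S.set_eigenvalue_list
  by (simp add: eigenvalue_list_conjugate[OF conjugate] is_eigenvalue_conjugate[OF conjugate])

lemma dirichlet_nonneg: "0 \<le> dirichlet E l \<phi> \<phi>"
  using edge_length unfolding dirichlet_def edge_length_def
  by (intro divide_nonneg_nonneg sum_nonneg) (auto simp: less_imp_le)

lemma mass_nonneg: "0 \<le> mass E l \<phi>"
  unfolding mass_def using m0_pos by (intro sum_nonneg) (simp add: less_imp_le)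

lemma mass_eq_0_iff: "mass E l \<phi> = 0 \<longleftrightarrow> \<phi> = 0"
proof -
  have "m0 E l a * (\<phi> $ a)\<^sup>2 \<ge> 0" for a using m0_pos[of a] by simp
  moreover have "m0 E l a \<noteq> 0" for a using m0_pos[of a] by simp
  ultimately show ?thesis by (simp add: mass_def sum_nonneg_eq_0_iff vec_eq_iff)
qed

lemma mass_ge: "m0 E l a * (\<phi> $ a)\<^sup>2 \<le> mass E l \<phi>"
  unfolding mass_def using m0_pos by (intro member_le_sum) (simp_all add: less_imp_le)

text \<open>Pulls Courant-Fischer back along \<open>weigh\<close>: subspaces correspond with equal
  dimension, and the two quadratic forms become energy and mass.\<close>

theorem spectrum_min_max:
  assumes "k < CARD('v)"
  shows "eigenvalue_list L ! k \<le> c \<longleftrightarrow>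
    (\<exists>V. subspace V \<and> dim V = Suc k \<and> (\<forall>\<phi>\<in>V. dirichlet E l \<phi> \<phi> \<le> c * mass E l \<phi>))"
    (is "_ \<longleftrightarrow> ?R")
proof -
  have dim_weigh: "dim (weigh ` V) = dim V" for V
    using linear_weigh by (intro dim_image_eq) (auto intro: inj_on_inverseI unweigh_weigh)
  have dim_unweigh: "dim (unweigh ` V) = dim V" for V
    using linear_unweigh by (intro dim_image_eq) (auto intro: inj_on_inverseI weigh_unweigh)
  have mass: "x \<bullet> x = mass E l (unweigh x)" for x
    using inner_weigh[of "unweigh x" "unweigh x"] by (simp add: weigh_unweigh mass_def power2_eq_square mult.assoc)
  have "eigenvalue_list L ! k \<le> c \<longleftrightarrow>
    (\<exists>V. subspace V \<and> dim V = Suc k \<and> (\<forall>x\<in>V. weigh (L (unweigh x)) \<bullet> x \<le> c * (x \<bullet> x)))" (is "_ \<longleftrightarrow> ?Q")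
    using S.courant_fischer[of k c] assms by (simp add: eigenvalue_list_conjugate[OF conjugate])
  also have "\<dots> \<longleftrightarrow> ?R"
  proof
    assume ?Q
    then obtain V where V: "subspace V" "dim V = Suc k" "\<forall>x\<in>V. weigh (L (unweigh x)) \<bullet> x \<le> c * (x \<bullet> x)" by blast
    then have "\<forall>\<phi>\<in>unweigh ` V. dirichlet E l \<phi> \<phi> \<le> c * mass E l \<phi>"
      by (auto simp: inner_weighted_laplacian mass)
    then show ?R
      using V(1,2) dim_unweigh[of V] linear_subspace_image[OF linear_unweigh V(1)] by auto
  next
    assume ?R
    then obtain V where V: "subspace V" "dim V = Suc k" "\<forall>\<phi>\<in>V. dirichlet E l \<phi> \<phi> \<le> c * mass E l \<phi>" by blast
    then have "\<forall>x\<in>weigh ` V. weigh (L (unweigh x)) \<bullet> x \<le> c * (x \<bullet> x)"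
      by (auto simp: inner_weighted_laplacian mass unweigh_weigh)
    then show ?Q
      using V(1,2) dim_weigh[of V] linear_subspace_image[OF linear_weigh V(1)] by auto
  qed
  finally show ?thesis .
qed

section \<open>Nonnegativity, the kernel and \<open>lambda1\<close>\<close>

text \<open>Energy is nonnegative, so a negative threshold admits only the zero function,
  contradicting dimension \<open>k + 1\<close>.\<close>

lemma spectrum_nonneg:
  assumes "k < CARD('v)"
  shows "0 \<le> eigenvalue_list L ! k"
proof (rule ccontr)
  assume "\<not> ?thesis"
  then obtain V where V: "subspace V" "dim V = Suc k"
    "\<forall>\<phi>\<in>V. dirichlet E l \<phi> \<phi> \<le> eigenvalue_list L ! k * mass E l \<phi>"
    using spectrum_min_max[OF assms] by blast
  have "\<phi> = 0" if "\<phi> \<in> V" for \<phi>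
  proof -
    have "0 \<le> eigenvalue_list L ! k * mass E l \<phi>"
      using V(3) that dirichlet_nonneg[of \<phi>] by force
    then show ?thesis using \<open>\<not> _\<close> mass_nonneg[of \<phi>]
      by (simp add: zero_le_mult_iff mass_eq_0_iff)
  qed
  then have "dim V = 0" by auto
  with V show False by simp
qed

text \<open>Every summand of the energy is nonnegative and hence zero, so values agree across edges
  and, by connectedness, along paths.\<close>

lemma dirichlet_eq_0_imp_constant:
  assumes "connected_graph E" "dirichlet E l \<phi> \<phi> = 0"
  shows "\<phi> $ a = \<phi> $ b"
proof -
  have nn: "0 \<le> (\<phi> $ a - \<phi> $ b) * (\<phi> $ a - \<phi> $ b) / l {a, b}" if "{a, b} \<in> E" for a b
    using edge_length that by (simp add: edge_length_def less_imp_le)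
  have edge: "\<phi> $ a = \<phi> $ b" if "{a, b} \<in> E" for a b
  proof -
    let ?g = "\<lambda>a. \<Sum>b | {a, b} \<in> E. (\<phi> $ a - \<phi> $ b) * (\<phi> $ a - \<phi> $ b) / l {a, b}"
    have "0 \<le> ?g a" for a by (rule sum_nonneg) (use nn in blast)
    moreover have "(\<Sum>a\<in>UNIV. ?g a) = 0" using assms(2) unfolding dirichlet_def by linarith
    ultimately have "?g a = 0" using sum_nonneg_eq_0_iff[of UNIV ?g] by simp
    then have "(\<phi> $ a - \<phi> $ b) * (\<phi> $ a - \<phi> $ b) / l {a, b} = 0"
      by (rule sum_nonneg_0[rotated 2]) (use nn that in auto)
    moreover have "0 < l {a, b}" using that edge_length by (simp add: edge_length_def)
    ultimately show ?thesis by simp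
  qed
  have "(a, b) \<in> {(x, y). {x, y} \<in> E}\<^sup>*"
    using assms(1) by (simp add: connected_graph_def)
  then show ?thesis by induction (auto dest: edge)
qed

lemma dirichlet_const [simp]: "dirichlet E l (\<chi> a. c) (\<chi> a. c) = 0"
  by (simp add: dirichlet_def)

lemma spectrum_0: "eigenvalue_list L ! 0 = 0"
proof (rule antisym)
  let ?V = "span {(\<chi> a. 1) :: real ^ 'v}"
  have "dim ?V = Suc 0" by (simp add: vec_eq_iff)
  moreover have "dirichlet E l \<phi> \<phi> \<le> 0 * mass E l \<phi>" if \<phi>: "\<phi> \<in> ?V" for \<phi>
  proof -
    obtain c where "\<phi> = c *\<^sub>R (\<chi> a. 1)" using \<phi> by (auto simp: span_singleton)
    then have "\<phi> = (\<chi> a. c)" by (simp add: vec_eq_iff)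
    then show ?thesis by simp
  qed
  ultimately have "eigenvalue_list L ! 0 \<le> 0 \<longleftrightarrow> True"
    using spectrum_min_max[of 0 0] subspace_span zero_less_card_finite by blast
  then show "eigenvalue_list L ! 0 \<le> 0" by simp
qed (simp add: spectrum_nonneg)

text \<open>Otherwise a two-dimensional space of functions would have zero energy, while
  connectedness leaves only the constants.\<close>

lemma spectrum_1_pos:
  assumes "connected_graph E" "CARD('v) \<ge> 2"
  shows "0 < eigenvalue_list L ! 1"
proof (rule ccontr)
  assume "\<not> ?thesis"
  then obtain V where V: "dim V = 2" "\<forall>\<phi>\<in>V. dirichlet E l \<phi> \<phi> \<le> 0"
    using spectrum_min_max[of 1 0] assms by (auto simp: not_less numeral_2_eq_2)
  have "V \<subseteq> span {(\<chi> a. 1) :: real ^ 'v}"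
  proof
    fix \<phi> assume "\<phi> \<in> V"
    then have "dirichlet E l \<phi> \<phi> = 0" using V dirichlet_nonneg[of \<phi>] by force
    \<comment> \<open>\<open>undefined\<close> serves as an arbitrary base vertex at which the
      constant value is read.\<close>
    then have "\<phi> = (\<phi> $ undefined) *\<^sub>R (\<chi> a. 1)"
      using dirichlet_eq_0_imp_constant[OF assms(1)] by (simp add: vec_eq_iff)
    then show "\<phi> \<in> span {(\<chi> a. 1) :: real ^ 'v}" by (metis span_base span_scale singletonI)
  qed
  then have "dim V \<le> dim {(\<chi> a. 1) :: real ^ 'v}" by (metis dim_span dim_subset)
  also have "\<dots> \<le> card {(\<chi> a. 1) :: real ^ 'v}" by (rule dim_le_card') simp
  finally show False using V by simp
qed

text \<open>Entry \<open>0\<close> of the sorted list is zero, so a positive eigenvalue stands at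
  index \<open>1\<close> or later.\<close>

lemma spectrum_1_le:
  assumes "0 < c" "is_eigenvalue L c"
  shows "eigenvalue_list L ! 1 \<le> c"
proof -
  obtain j where j: "j < CARD('v)" "c = eigenvalue_list L ! j"
    using assms(2) set_spectrum length_spectrum by (metis in_set_conv_nth mem_Collect_eq)
  then have "1 \<le> j" using assms(1) spectrum_0 by (cases j) auto
  then show ?thesis using j sorted_nth_mono[OF sorted_spectrum] length_spectrum by metis
qed

lemma is_eigenvalue_spectrum_1: "CARD('v) \<ge> 2 \<Longrightarrow> is_eigenvalue L (eigenvalue_list L ! 1)"
  using set_spectrum length_spectrum nth_mem[of 1 "eigenvalue_list L"] by auto

lemma lambda1_eq:
  assumes "connected_graph E" "CARD('v) \<ge> 2"
  shows "lambda1 E l = eigenvalue_list L ! 1"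
  unfolding lambda1_def
  using spectrum_1_pos[OF assms] is_eigenvalue_spectrum_1[OF assms(2)] spectrum_1_le
  by (intro Least_equality) auto

end

text \<open>Each vertex has another vertex to reach, and the first edge of a path to it supplies a
  positive term of \<open>m0\<close>.\<close>

lemma metric_graphI:
  fixes E :: "'v::finite set set"
  assumes "connected_graph E" "CARD('v) \<ge> 2" "edge_length E l"
  shows "metric_graph E l"
proof
  show "0 < m0 E l a" for a
  proof -
    have "\<exists>b. b \<noteq> a"
    proof (rule ccontr)
      assume "\<not> ?thesis"
      then have "(UNIV :: 'v set) = {a}" by auto
      then have "CARD('v) = 1" by (metis is_singletonI is_singleton_altdef)
      with assms(2) show False by simp
    qed
    then obtain b where "b \<noteq> a" by blast
    moreover have "(a, b) \<in> {(x, y). {x, y} \<in> E}\<^sup>*"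
      using assms(1) by (simp add: connected_graph_def)
    ultimately obtain c where "{a, c} \<in> E" by (auto elim: converse_rtranclE)
    then show ?thesis
      unfolding m0_def using assms(3) by (intro sum_pos) (auto simp: edge_length_def)
  qed
qed (fact assms)

text \<open>Dividing lengths by \<open>r\<close> multiplies \<open>m1\<close> by \<open>r\<close>
  and divides \<open>m0\<close> by \<open>r\<close>, so the Laplacian gains the factor
  \<open>r\<^sup>2\<close>. This allows the total weight to be renormalized to 1.\<close>

lemma lambda1_scale:
  fixes E :: "'v::finite set set"
  assumes "connected_graph E" "CARD('v) \<ge> 2" "edge_length E l" "r > 0"
  shows "lambda1 E (\<lambda>e. l e / r) = r\<^sup>2 * lambda1 E l"
proof -
  interpret metric_graph E l using assms metric_graphI by blast
  have m0_eq: "m0 E (\<lambda>e. l e / r) a = m0 E l a / r" for a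
    by (simp add: m0_def sum_divide_distrib)
  have "fujiwara_laplacian E (\<lambda>e. l e / r) \<phi> = r\<^sup>2 *\<^sub>R L \<phi>" for \<phi>
    using assms(4)
    by (simp add: fujiwara_laplacian_def m0_eq m1_def vec_eq_iff sum_distrib_left power2_eq_square field_simps)
  then have ev: "is_eigenvalue (fujiwara_laplacian E (\<lambda>e. l e / r)) c \<longleftrightarrow> is_eigenvalue L (c / r\<^sup>2)" for c
    using assms(4) by (simp add: is_eigenvalue_def eigenspace_def vec_eq_iff field_simps)
  show ?thesis
    unfolding lambda1_def[of E "\<lambda>e. l e / r"] ev
  proof (intro Least_equality)
    show "0 < r\<^sup>2 * lambda1 E l \<and> is_eigenvalue L (r\<^sup>2 * lambda1 E l / r\<^sup>2)"
      using lambda1_eq[OF assms(1,2)] spectrum_1_pos[OF assms(1,2)]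
        is_eigenvalue_spectrum_1[OF assms(2)] assms(4) by simp
    fix c assume "0 < c \<and> is_eigenvalue L (c / r\<^sup>2)"
    then have "lambda1 E l \<le> c / r\<^sup>2"
      using spectrum_1_le[of "c / r\<^sup>2"] lambda1_eq[OF assms(1,2)] assms(4) by simp
    then show "r\<^sup>2 * lambda1 E l \<le> c" using assms(4) by (simp add: field_simps)
  qed
qed

section \<open>Attaching a pendant edge\<close>

lemma sum_UNIV_option:
  fixes f :: "'v::finite option \<Rightarrow> real"
  shows "(\<Sum>x\<in>UNIV. f x) = f None + (\<Sum>a\<in>UNIV. f (Some a))"
  by (simp add: UNIV_option_conv sum.reindex)

lemma Some_image_eq_iff: "Some ` e = Some ` f \<longleftrightarrow> e = f"
  by (simp add: inj_image_eq_iff)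

lemma pendant_edge_iff [simp]:
  "{Some a, Some b} \<in> pendant_graph E u \<longleftrightarrow> {a, b} \<in> E"
  "{Some a, None} \<in> pendant_graph E u \<longleftrightarrow> a = u"
  "{None, Some a} \<in> pendant_graph E u \<longleftrightarrow> a = u"
  "{None} \<notin> pendant_graph E u"
proof -
  have "{Some a, Some b} = Some ` {a, b}" by simp
  moreover have "None \<notin> Some ` e" for e :: "'a set" by auto
  moreover have "None \<notin> {Some a, Some b}" by simp
  ultimately show "{Some a, Some b} \<in> pendant_graph E u \<longleftrightarrow> {a, b} \<in> E"
    by (auto simp: pendant_graph_def Some_image_eq_iff simp del: image_insert)
  show 2: "{Some a, None} \<in> pendant_graph E u \<longleftrightarrow> a = u" for a
    by (auto simp: pendant_graph_def doubleton_eq_iff)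
  show "{None, Some a} \<in> pendant_graph E u \<longleftrightarrow> a = u"
    using 2 by (simp add: insert_commute)
  show "{None} \<notin> pendant_graph E u"
    by (auto simp: pendant_graph_def)
qed

lemma pendant_length_simps [simp]:
  "pendant_length l u t {Some a, Some b} = l {a, b}"
  "pendant_length l u t {Some u, None} = t"
  "pendant_length l u t {None, Some u} = t"
proof -
  have "{Some a, Some b} \<noteq> {Some u, None}" by auto
  moreover have "Some -` {Some a, Some b} = {a, b}" by auto
  ultimately show "pendant_length l u t {Some a, Some b} = l {a, b}"
    by (simp add: pendant_length_def)
qed (simp_all add: pendant_length_def insert_commute)

lemma sum_pendant_neighbours:
  fixes f :: "'v::finite option \<Rightarrow> real"
  shows "(\<Sum>x | {Some a, x} \<in> pendant_graph E u. f x) =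
    (\<Sum>b | {a, b} \<in> E. f (Some b)) + (if a = u then f None else 0)"
    and "(\<Sum>x | {None, x} \<in> pendant_graph E u. f x) = f (Some u)"
proof -
  have "{x. {Some a, x} \<in> pendant_graph E u} = Some ` {b. {a, b} \<in> E} \<union> (if a = u then {None} else {})"
  proof (rule set_eqI)
    show "x \<in> {x. {Some a, x} \<in> pendant_graph E u} \<longleftrightarrow>
      x \<in> Some ` {b. {a, b} \<in> E} \<union> (if a = u then {None} else {})" for x
      by (cases x) auto
  qed
  then show "(\<Sum>x | {Some a, x} \<in> pendant_graph E u. f x) =
    (\<Sum>b | {a, b} \<in> E. f (Some b)) + (if a = u then f None else 0)"
    by (auto simp: sum.reindex)
  have "{x. {None, x} \<in> pendant_graph E u} = {Some u}"
  proof (rule set_eqI)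
    show "x \<in> {x. {None, x} \<in> pendant_graph E u} \<longleftrightarrow> x \<in> {Some u}" for x
      by (cases x) auto
  qed
  then show "(\<Sum>x | {None, x} \<in> pendant_graph E u. f x) = f (Some u)" by simp
qed

lemma m0_pendant:
  "m0 (pendant_graph E u) (pendant_length l u t) (Some a) = m0 E l a + (if a = u then t else 0)"
  "m0 (pendant_graph E u) (pendant_length l u t) None = t"
  by (simp_all add: m0_def sum_pendant_neighbours)

lemma connected_pendant_graph:
  assumes "connected_graph E"
  shows "connected_graph (pendant_graph E u)"
proof -
  let ?R = "{(x, y). {x, y} \<in> pendant_graph E u}"
  have Some: "(Some a, Some b) \<in> ?R\<^sup>*" for a b
  proof -
    have "(a, b) \<in> {(x, y). {x, y} \<in> E}\<^sup>*" using assms by (simp add: connected_graph_def)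
    then show ?thesis by induction (auto elim!: rtrancl_into_rtrancl)
  qed
  have "(None, Some u) \<in> ?R" "(Some u, None) \<in> ?R" by auto
  then have "(None, Some a) \<in> ?R\<^sup>*" "(Some a, None) \<in> ?R\<^sup>*" for a
    using Some by (blast intro: converse_rtrancl_into_rtrancl rtrancl_into_rtrancl)+
  then have "(x, y) \<in> ?R\<^sup>*" for x y
    using Some by (cases x; cases y) blast+
  then show ?thesis by (simp add: connected_graph_def)
qed

lemma edge_length_pendant:
  assumes "edge_length E l" "0 < t"
  shows "edge_length (pendant_graph E u) (pendant_length l u t)"
proof -
  have "Some -` (Some ` e) = e" for e :: "'a set" by auto
  then show ?thesis
    using assms by (auto simp: edge_length_def pendant_graph_def pendant_length_def)
qed

section \<open>Transfer of functions between the two graphs\<close>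

definition restrict_old :: "real ^ 'v::finite option \<Rightarrow> real ^ 'v" where
  "restrict_old \<phi> = (\<chi> a. \<phi> $ Some a)"

text \<open>Copying the value at \<open>u\<close> to the new vertex puts no energy on the pendant
  edge.\<close>

definition extend_constantly :: "'v::finite \<Rightarrow> real ^ 'v \<Rightarrow> real ^ 'v option" where
  "extend_constantly u \<phi> = (\<chi> x. case x of None \<Rightarrow> \<phi> $ u | Some a \<Rightarrow> \<phi> $ a)"

lemma linear_restrict_old: "linear restrict_old"
  by (intro linearI) (simp_all add: restrict_old_def vec_eq_iff)

lemma linear_extend_constantly: "linear (extend_constantly u)"
  by (intro linearI) (simp_all add: extend_constantly_def vec_eq_iff split: option.split)

lemma restrict_extend [simp]: "restrict_old (extend_constantly u \<phi>) = \<phi>"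
  by (simp add: restrict_old_def extend_constantly_def vec_eq_iff)

text \<open>The ordered sum meets the pendant edge from both ends, and the factor one half leaves a
  single term.\<close>

lemma dirichlet_pendant:
  "dirichlet (pendant_graph E u) (pendant_length l u t) \<phi> \<phi> =
    dirichlet E l (restrict_old \<phi>) (restrict_old \<phi>) + (\<phi> $ Some u - \<phi> $ None)\<^sup>2 / t"
  unfolding dirichlet_def
  by (simp add: sum_UNIV_option sum_pendant_neighbours restrict_old_def sum.distrib
      if_distrib[of "\<lambda>l. _ / l"] sum.delta add_divide_distrib power2_eq_square cong: if_cong)
     (simp add: field_simps)

text \<open>The pendant edge raises the weight of \<open>u\<close> by \<open>t\<close> and gives the
  new vertex weight \<open>t\<close>.\<close>

lemma mass_pendant:
  "mass (pendant_graph E u) (pendant_length l u t) \<phi> =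
    mass E l (restrict_old \<phi>) + t * (\<phi> $ Some u)\<^sup>2 + t * (\<phi> $ None)\<^sup>2"
proof -
  have "(\<Sum>a\<in>UNIV. (m0 E l a + (if a = u then t else 0)) * (\<phi> $ Some a)\<^sup>2) =
    (\<Sum>a\<in>UNIV. m0 E l a * (\<phi> $ Some a)\<^sup>2 + (if a = u then t * (\<phi> $ Some u)\<^sup>2 else 0))"
    by (intro sum.cong) (auto simp: algebra_simps)
  then show ?thesis
    by (simp add: mass_def sum_UNIV_option m0_pendant restrict_old_def sum.distrib)
qed

lemma dirichlet_0: "dirichlet E l 0 0 = 0"
  by (simp add: dirichlet_def)

locale pendant_metric_graph = metric_graph E l
  for E :: "'v::finite set set" and l +
  fixes u :: 'v
  assumes connected: "connected_graph E" and card: "CARD('v) \<ge> 2"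
begin

abbreviation "E' \<equiv> pendant_graph E u"

abbreviation "l' \<equiv> pendant_length l u"

abbreviation "L' t \<equiv> fujiwara_laplacian E' (l' t)"

lemma metric_graph_pendant: "0 < t \<Longrightarrow> metric_graph E' (l' t)"
  using connected_pendant_graph[OF connected] card edge_length_pendant[OF edge_length]
  by (intro metric_graphI) simp_all

section \<open>Two-sided bounds and convergence of the lower eigenvalues\<close>

text \<open>An optimal subspace on the old graph is extended constantly. Since
  \<open>eigenvalue_list L ! k\<close> is nonnegative, the increase in mass only weakens the
  required bound.\<close>

lemma pendant_spectrum_le:
  assumes t: "0 < t" and k: "k < CARD('v)"
  shows "eigenvalue_list (L' t) ! k \<le> eigenvalue_list L ! k"
proof -
  interpret P: metric_graph E' "l' t" using metric_graph_pendant[OF t] .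
  let ?c = "eigenvalue_list L ! k"
  obtain V where V: "subspace V" "dim V = Suc k" "\<forall>\<phi>\<in>V. dirichlet E l \<phi> \<phi> \<le> ?c * mass E l \<phi>"
    using spectrum_min_max[OF k, of ?c] by auto
  let ?W = "extend_constantly u ` V"
  have "subspace ?W" by (intro linear_subspace_image linear_extend_constantly V)
  moreover have "dim ?W = Suc k"
    using V(2) by (subst dim_image_eq)
      (auto intro: linear_extend_constantly inj_on_inverseI[of _ restrict_old])
  moreover have "\<forall>\<phi>\<in>?W. dirichlet E' (l' t) \<phi> \<phi> \<le> ?c * mass E' (l' t) \<phi>"
  proof safe
    fix \<phi> assume "\<phi> \<in> V"
    let ?\<psi> = "extend_constantly u \<phi>"
    have "dirichlet E' (l' t) ?\<psi> ?\<psi> = dirichlet E l \<phi> \<phi>"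
      by (simp add: dirichlet_pendant) (simp add: extend_constantly_def)
    also have "\<dots> \<le> ?c * mass E l \<phi>" using V(3) \<open>\<phi> \<in> V\<close> by blast
    also have "\<dots> \<le> ?c * mass E' (l' t) ?\<psi>"
      using t by (intro mult_left_mono spectrum_nonneg k) (simp add: mass_pendant)
    finally show "dirichlet E' (l' t) ?\<psi> ?\<psi> \<le> ?c * mass E' (l' t) ?\<psi>" .
  qed
  ultimately show ?thesis using P.spectrum_min_max[of k ?c] k by auto
qed

text \<open>
  If \<open>\<phi>\<close> has Rayleigh quotient at most \<open>c\<close>, then
  \<open>(\<phi> u - \<phi> None)\<^sup>2 \<le> t * c * mass \<phi>\<close>, so that almost all of the mass of
  \<open>\<phi>\<close> sits on the old graph.
\<close>

lemma spectrum_le_pendant: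
  assumes t: "0 < t" and k: "k < CARD('v)" and small: "2 * t\<^sup>2 * eigenvalue_list L ! k < 1"
  shows "eigenvalue_list L ! k * (1 - 2 * t\<^sup>2 * eigenvalue_list L ! k) / (1 + 3 * t / m0 E l u)
    \<le> eigenvalue_list (L' t) ! k"
proof -
  interpret P: metric_graph E' "l' t" using metric_graph_pendant[OF t] .
  let ?C = "eigenvalue_list L ! k" and ?c = "eigenvalue_list (L' t) ! k"
  \<comment> \<open>\<open>q\<close> and \<open>p\<close> are the factors in the mass comparison
    below: \<open>q\<close> pays for the difference along the pendant edge, \<open>p\<close> for the
    value at \<open>u\<close> counted up to three times.\<close>
  define q where "q = 1 - 2 * t\<^sup>2 * ?C"
  define p where "p = 1 + 3 * t / m0 E l u"
  have q: "0 < q" using small by (simp add: q_def)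
  have p: "0 < p" using t m0_pos[of u] by (simp add: p_def add_pos_pos)
  have c: "0 \<le> ?c" using P.spectrum_nonneg[of k] k by simp
  have cC: "?c \<le> ?C" by (rule pendant_spectrum_le[OF t k])
  obtain V where V: "subspace V" "dim V = Suc k"
    "\<forall>\<phi>\<in>V. dirichlet E' (l' t) \<phi> \<phi> \<le> ?c * mass E' (l' t) \<phi>"
    using P.spectrum_min_max[of k ?c] k by auto
  have mass: "q * mass E' (l' t) \<phi> \<le> p * mass E l (restrict_old \<phi>)" if "\<phi> \<in> V" for \<phi>
  proof -
    define M where "M = mass E' (l' t) \<phi>"
    define x where "x = \<phi> $ Some u"
    define y where "y = \<phi> $ None"
    have M0: "0 \<le> M" unfolding M_def by (rule P.mass_nonneg)
    have "(x - y)\<^sup>2 / t \<le> ?c * M"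
      using V(3)[rule_format, OF that] dirichlet_nonneg[of "restrict_old \<phi>"]
      by (simp add: dirichlet_pendant M_def x_def y_def)
    \<comment> \<open>Passing to the limit eigenvalue \<open>?C\<close> keeps \<open>q\<close>
      explicit in \<open>t\<close>.\<close>
    also have "\<dots> \<le> ?C * M" using cC M0 by (rule mult_right_mono)
    finally have "(x - y)\<^sup>2 \<le> t * (?C * M)" using t by (simp add: field_simps)
    then have "2 * t * (x - y)\<^sup>2 \<le> 2 * t * (t * (?C * M))" using t by simp
    moreover have "t * y\<^sup>2 \<le> t * (2 * x\<^sup>2 + 2 * (x - y)\<^sup>2)"
    proof -
      \<comment> \<open>This square is exactly the gap in the next inequality, which trades the
        value at the new vertex for the value at \<open>u\<close> and the difference controlled by
        the energy.\<close>
      have "0 \<le> (2 * x - y)\<^sup>2" by simp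
      then have "y\<^sup>2 \<le> 2 * x\<^sup>2 + 2 * (x - y)\<^sup>2" by (simp add: power2_eq_square algebra_simps)
      then show ?thesis using t by simp
    qed
    moreover have "M = mass E l (restrict_old \<phi>) + t * x\<^sup>2 + t * y\<^sup>2"
      by (simp add: M_def mass_pendant x_def y_def)
    moreover have "x\<^sup>2 \<le> mass E l (restrict_old \<phi>) / m0 E l u"
      using mass_ge[of u "restrict_old \<phi>"] m0_pos[of u]
      by (simp add: restrict_old_def x_def field_simps)
    then have "3 * t * x\<^sup>2 \<le> 3 * t * (mass E l (restrict_old \<phi>) / m0 E l u)"
      using t by (intro mult_left_mono) simp_all
    ultimately have "M \<le> mass E l (restrict_old \<phi>) +
        3 * t * (mass E l (restrict_old \<phi>) / m0 E l u) + 2 * t * (t * (?C * M))"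
      by (simp add: algebra_simps)
    then show ?thesis
      by (simp add: M_def[symmetric] p_def q_def algebra_simps power2_eq_square)
  qed
  let ?W = "restrict_old ` V"
  have sub: "subspace ?W" by (intro linear_subspace_image linear_restrict_old V)
  \<comment> \<open>A function vanishing on the old graph has no mass by the comparison, as
    \<open>q\<close> is positive; hence restriction preserves the dimension of
    \<open>V\<close>.\<close>
  have "\<phi> = 0" if "\<phi> \<in> V" "restrict_old \<phi> = 0" for \<phi>
  proof -
    have "q * mass E' (l' t) \<phi> \<le> 0" using mass[OF that(1)] that(2) by (simp add: mass_eq_0_iff[THEN iffD2])
    then have "mass E' (l' t) \<phi> = 0"
      using q P.mass_nonneg[of \<phi>] by (simp add: mult_le_0_iff)
    then show ?thesis by (simp add: P.mass_eq_0_iff)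
  qed
  then have "inj_on restrict_old V"
    using linear_inj_on_iff_eq_0[OF linear_restrict_old V(1)] by blast
  then have dim: "dim ?W = Suc k"
    using V by (simp add: dim_image_eq linear_restrict_old span_eq_iff[THEN iffD2])
  have "\<forall>\<phi>\<in>?W. dirichlet E l \<phi> \<phi> \<le> (?c * p / q) * mass E l \<phi>"
  proof safe
    fix \<phi> assume \<phi>: "\<phi> \<in> V"
    have "dirichlet E l (restrict_old \<phi>) (restrict_old \<phi>) \<le> dirichlet E' (l' t) \<phi> \<phi>"
      using t by (simp add: dirichlet_pendant)
    also have "\<dots> \<le> ?c * mass E' (l' t) \<phi>" using V(3) \<phi> by blast
    also have "\<dots> \<le> ?c * (p * mass E l (restrict_old \<phi>) / q)"
      using mass[OF \<phi>] q by (intro mult_left_mono c) (simp add: field_simps)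
    finally show "dirichlet E l (restrict_old \<phi>) (restrict_old \<phi>) \<le> (?c * p / q) * mass E l (restrict_old \<phi>)"
      by simp
  qed
  then have "?C \<le> ?c * p / q" using spectrum_min_max[OF k] sub dim by blast
  then have "?C * q / p \<le> ?c" using p q by (simp add: field_simps)
  then show ?thesis by (simp add: p_def q_def)
qed

text \<open>Squeezed between the constant upper bound and the explicit lower bound, which tends to
  the same value.\<close>

lemma tendsto_pendant_spectrum:
  assumes k: "k < CARD('v)"
  shows "((\<lambda>t. eigenvalue_list (L' t) ! k) \<longlongrightarrow> eigenvalue_list L ! k) (at_right 0)"
proof (rule tendsto_sandwich)
  let ?C = "eigenvalue_list L ! k"
  let ?f = "\<lambda>t. ?C * (1 - 2 * t\<^sup>2 * ?C) / (1 + 3 * t / m0 E l u)"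
  have "(?f \<longlongrightarrow> ?C * (1 - 2 * 0\<^sup>2 * ?C) / (1 + 3 * 0 / m0 E l u)) (at_right 0)"
    by (intro tendsto_intros) (use m0_pos[of u] in auto)
  then show "(?f \<longlongrightarrow> ?C) (at_right 0)" by simp
  have pos: "\<forall>\<^sub>F t in at_right 0. (0::real) < t" by (simp add: eventually_at_right_less)
  have "((\<lambda>t. 2 * t\<^sup>2 * ?C) \<longlongrightarrow> 2 * 0\<^sup>2 * ?C) (at_right 0)" by (intro tendsto_intros)
  then have "\<forall>\<^sub>F t in at_right 0. 2 * t\<^sup>2 * ?C < 1" by (rule order_tendstoD) simp
  with pos show "\<forall>\<^sub>F t in at_right 0. ?f t \<le> eigenvalue_list (L' t) ! k"
    by eventually_elim (rule spectrum_le_pendant[OF _ k])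
  from pos show "\<forall>\<^sub>F t in at_right 0. eigenvalue_list (L' t) ! k \<le> ?C"
    by eventually_elim (rule pendant_spectrum_le[OF _ k])
qed simp

section \<open>Divergence of the largest eigenvalue\<close>

lemma last_pendant_spectrum_ge:
  assumes t: "0 < t"
  shows "1 / t\<^sup>2 \<le> last (eigenvalue_list (L' t))"
proof -
  interpret P: metric_graph E' "l' t" using metric_graph_pendant[OF t] .
  \<comment> \<open>Indices start at \<open>0\<close>, so \<open>CARD('v)\<close> is the index of
    the last of the \<open>CARD('v) + 1\<close> eigenvalues; its test space is everything.\<close>
  let ?c = "eigenvalue_list (L' t) ! CARD('v)"
  obtain V where V: "dim V = Suc CARD('v)"
    "\<forall>\<phi>\<in>V. dirichlet E' (l' t) \<phi> \<phi> \<le> ?c * mass E' (l' t) \<phi>" "subspace V"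
    using P.spectrum_min_max[of "CARD('v)" ?c] by auto
  then have "V = UNIV" using dim_eq_full[of V] by (simp add: span_eq_iff[THEN iffD2])
  \<comment> \<open>The indicator of the new vertex has energy \<open>1 / t\<close> and mass
    \<open>t\<close>.\<close>
  let ?\<phi> = "axis None 1 :: real ^ 'v option"
  have "restrict_old ?\<phi> = 0" by (simp add: restrict_old_def axis_def vec_eq_iff)
  moreover have "?\<phi> $ Some u = 0" "?\<phi> $ None = 1" by (simp_all add: axis_def)
  ultimately have "1 / t \<le> ?c * t"
    using V(2)[rule_format, of ?\<phi>] \<open>V = UNIV\<close>
    by (simp add: dirichlet_pendant mass_pendant mass_eq_0_iff[THEN iffD2] dirichlet_0)
  then have "1 / t\<^sup>2 \<le> ?c" using t by (simp add: field_simps power2_eq_square)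
  moreover have "last (eigenvalue_list (L' t)) = ?c"
    using P.length_spectrum by (subst last_conv_nth) auto
  ultimately show ?thesis by simp
qed

lemma last_pendant_spectrum_at_top:
  "filterlim (\<lambda>t. last (eigenvalue_list (L' t))) at_top (at_right 0)"
proof (rule filterlim_at_top_mono)
  have "filterlim (\<lambda>t::real. inverse t ^ 2) at_top (at_right 0)"
    by (intro filterlim_pow_at_top filterlim_inverse_at_top_right) simp
  then show "filterlim (\<lambda>t::real. 1 / t\<^sup>2) at_top (at_right 0)"
    by (simp add: field_simps)
  have "\<forall>\<^sub>F t in at_right 0. (0::real) < t" by (simp add: eventually_at_right_less)
  then show "\<forall>\<^sub>F t in at_right 0. 1 / t\<^sup>2 \<le> last (eigenvalue_list (L' t))"
    by eventually_elim (rule last_pendant_spectrum_ge)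
qed

section \<open>Consequences for \<open>lambda1\<close> and \<open>Lambda1\<close>\<close>

lemma lambda1_pendant:
  assumes "0 < t"
  shows "lambda1 E' (l' t) = eigenvalue_list (L' t) ! 1"
  using metric_graph.lambda1_eq[OF metric_graph_pendant[OF assms] connected_pendant_graph[OF connected]] card
  by simp

lemma tendsto_lambda1_pendant: "((\<lambda>t. lambda1 E' (l' t)) \<longlongrightarrow> lambda1 E l) (at_right 0)"
proof -
  have "\<forall>\<^sub>F t in at_right 0. lambda1 E' (l' t) = eigenvalue_list (L' t) ! 1"
    using eventually_at_right_less by eventually_elim (rule lambda1_pendant)
  moreover have "((\<lambda>t. eigenvalue_list (L' t) ! 1) \<longlongrightarrow> lambda1 E l) (at_right 0)"
    using tendsto_pendant_spectrum[of 1] card lambda1_eq[OF connected card] by simp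
  ultimately show ?thesis by (simp add: tendsto_cong)
qed

text \<open>The new edge raises the total weight to \<open>1 + 2 * t\<close>. Dividing all lengths
  by this number makes them admissible in the supremum and costs a factor
  \<open>(1 + 2 * t)\<^sup>2\<close>, which tends to 1.\<close>

lemma lambda1_le_Lambda1_pendant:
  assumes "(\<Sum>a\<in>UNIV. m0 E l a) = 1"
  shows "ereal (lambda1 E l) \<le> Lambda1 E'"
proof (rule tendsto_upperbound)
  have "((\<lambda>t. (1 + 2 * t)\<^sup>2 * lambda1 E' (l' t)) \<longlongrightarrow> (1 + 2 * 0)\<^sup>2 * lambda1 E l) (at_right 0)"
    by (intro tendsto_intros tendsto_lambda1_pendant)
  then show "((\<lambda>t. ereal ((1 + 2 * t)\<^sup>2 * lambda1 E' (l' t))) \<longlongrightarrow> ereal (lambda1 E l)) (at_right 0)"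
    by simp
  have "ereal ((1 + 2 * t)\<^sup>2 * lambda1 E' (l' t)) \<le> Lambda1 E'" if t: "0 < t" for t
  proof -
    let ?l = "\<lambda>e. l' t e / (1 + 2 * t)"
    have "(\<Sum>x\<in>UNIV. m0 E' (l' t) x) = 1 + 2 * t"
      using assms by (simp add: sum_UNIV_option m0_pendant sum.distrib)
    moreover have "m0 E' ?l x = m0 E' (l' t) x / (1 + 2 * t)" for x
      by (simp add: m0_def sum_divide_distrib)
    ultimately have "(\<Sum>x\<in>UNIV. m0 E' ?l x) = 1"
      using t by (simp add: sum_divide_distrib[symmetric])
    moreover have el: "edge_length E' (l' t)" by (rule edge_length_pendant[OF edge_length t])
    then have "edge_length E' ?l" using t by (simp add: edge_length_def)
    ultimately have "ereal (lambda1 E' ?l) \<le> Lambda1 E'"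
      unfolding Lambda1_def by (intro SUP_upper) simp
    moreover have "lambda1 E' ?l = (1 + 2 * t)\<^sup>2 * lambda1 E' (l' t)"
      using connected_pendant_graph[OF connected] card el t by (intro lambda1_scale) simp_all
    ultimately show ?thesis by simp
  qed
  then show "\<forall>\<^sub>F t in at_right 0. ereal ((1 + 2 * t)\<^sup>2 * lambda1 E' (l' t)) \<le> Lambda1 E'"
    using eventually_at_right_less[of "0::real"] by (rule eventually_mono[rotated])
qed simp

end

theorem theorem3p1:
  fixes E :: "'v::finite set set" and l :: "'v set \<Rightarrow> real" and u :: 'v
  assumes "CARD('v) \<ge> 2"
    and "simple_graph E" and "connected_graph E"
    and "edge_length E l"
  defines "n \<equiv> CARD('v)"
    and "E' \<equiv> pendant_graph E u"
    and "ev \<equiv> eigenvalue_list (fujiwara_laplacian E l)"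
    and "ev' \<equiv> (\<lambda>t. eigenvalue_list (fujiwara_laplacian (pendant_graph E u) (pendant_length l u t)))"
  shows "length ev = n \<and> (\<forall>t>0. length (ev' t) = n + 1)
    \<and> filterlim (\<lambda>t. last (ev' t)) at_top (at_right 0)
    \<and> (\<forall>k<n. ((\<lambda>t. ev' t ! k) \<longlongrightarrow> ev ! k) (at_right 0))
    \<and> ((\<lambda>t. lambda1 E' (pendant_length l u t)) \<longlongrightarrow> lambda1 E l) (at_right 0)
    \<and> Lambda1 E \<le> Lambda1 E'"
proof -
  \<comment> \<open>Kept general in the length function, because the comparison of suprema uses
    every normalized length on the old graph.\<close>
  have pendant: "pendant_metric_graph E l" if "edge_length E l" for l
    using metric_graphI[OF assms(3,1) that] assms(1,3)
    by (simp add: pendant_metric_graph_def pendant_metric_graph_axioms_def)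
  interpret pendant_metric_graph E l u using pendant assms(4) .
  have "length (ev' t) = n + 1" if "0 < t" for t
    using metric_graph.length_spectrum[OF metric_graph_pendant[OF that]] by (simp add: ev'_def n_def)
  moreover have "Lambda1 E \<le> Lambda1 E'"
    unfolding Lambda1_def[of E] E'_def
    by (intro SUP_least) (auto intro: pendant_metric_graph.lambda1_le_Lambda1_pendant[OF pendant])
  ultimately show ?thesis
    using length_spectrum last_pendant_spectrum_at_top tendsto_pendant_spectrum tendsto_lambda1_pendant
    by (simp add: n_def E'_def ev_def ev'_def)
qed

end
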